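(* Let $a<b$ be real numbers and let $\varphi$ be a convex $\varphi$-function. Let $\sigma:\mathbb{R}\to\mathbb{R}$ be a non-decreasing sigmoidal function satisfying $(\Sigma 1)$, $(\Sigma 2)$ and $(\Sigma 3)$ with $\alpha\geq 1$, and with $\phi_\sigma(2)>0$. Let $f\in L^{\varphi}_+([a,b])$. Then there exist $\lambda_0>0$ and $\lambda_1>0$ such that $$I^{\varphi}\left[\lambda_1\left(K^{(M)}_n(f,\cdot)-f(\cdot)\right)\right]\leq A_1\,\mathcal{K}\left(f,\lambda_0,A_2\,n^{-1}\right)_\varphi$$ for every sufficiently large $n\in\mathbb{N}^+$, where $$A_1:=\|\phi_\sigma\|_1+1,\qquad A_2:=\frac{3\,\lambda_0\,(b-a)}{4\,\phi_\sigma(2)\left(\|\phi_\sigma\|_1+1\right)}.$$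
   Context: A $\varphi$-function is a function $\varphi:[0,+\infty)\to[0,+\infty)$ such that $\varphi(0)=0$, $\varphi(u)>0$ for every $u>0$, $\varphi$ is continuous and non-decreasing, and $\lim_{u\to+\infty}\varphi(u)=+\infty$. Let $M([a,b])$ be the set of Lebesgue measurable functions $f:[a,b]\to\mathbb{R}$. The modular is $I^{\varphi}[f]:=\int_a^b\varphi(|f(x)|)\,dx\in[0,+\infty]$ for $f\in M([a,b])$. The Orlicz space is $L^{\varphi}([a,b]):=\{f\in M([a,b]): I^{\varphi}[\lambda f]<+\infty \text{ for some } \lambda>0\}$, and $L^{\varphi}_+([a,b])$ is the set of its non-negative elements. A measurable function $\sigma:\mathbb{R}\to\mathbb{R}$ is sigmoidal if $\lim_{x\to-\infty}\sigma(x)=0$ and $\lim_{x\to+\infty}\sigma(x)=1$. Put $\phi_\sigma(x):=\frac12[\sigma(x+1)-\sigma(x-1)]$, $x\in\mathbb{R}$, and $\|\phi_\sigma\|_1:=\int_{\mathbb{R}}\phi_\sigma(y)\,dy$ (finite under the assumptions here). The conditions are: $(\Sigma 1)$ $\sigma(x)-1/2$ is an odd function; $(\Sigma 2)$ $\phi_\sigma$ is non-decreasing for $x<0$ and non-increasing for $x\geq 0$; $(\Sigma 3)$ $\sigma(x)=\mathcal{O}(|x|^{-\alpha})$ as $x\to-\infty$, for the indicated exponent $\alpha$. For $n\in\mathbb{N}^+$ let $\mathcal{J}_n:=\{k\in\mathbb{Z}: \lceil na\rceil\leq k\leq\lfloor nb\rfloor-1\}$; this is non-empty for all sufficiently large $n$,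 and for such $n$ the Kantorovich max-product neural network operator is $$K^{(M)}_n(f,x):=\frac{\bigvee_{k\in\mathcal{J}_n}\left[n\int_{k/n}^{(k+1)/n}f(u)\,du\right]\phi_\sigma(nx-k)}{\bigvee_{k\in\mathcal{J}_n}\phi_\sigma(nx-k)},\qquad x\in[a,b],$$ where $\bigvee_{k\in\mathcal{J}}A_k:=\sup\{A_k: k\in\mathcal{J}\}$. Let $C^1_+([a,b])$ be the set of non-negative differentiable functions on $[a,b]$ with continuous derivative. For $f\in L^{\varphi}_+([a,b])$, $\lambda>0$ and $\delta>0$, the K-functional is $$\mathcal{K}(f,\lambda,\delta)_\varphi:=\inf_{g\in C^1_+([a,b])}\left\{I^{\varphi}\left[\lambda(f(\cdot)-g(\cdot))\right]+\delta\,\varphi\left(\|g'\|_\infty\right)\right\},$$ where $\|\cdot\|_\infty$ is the sup-norm on $[a,b]$ (for each $f\in L^{\varphi}_+([a,b])$ it is finite for some $\lambda>0$). *)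

theory Defs
  imports "HOL-Analysis.Analysis" "HOL-Library.Landau_Symbols"
begin

text \<open>
  Functions on \<open>[0, +\<infinity>)\<close>, respectively on \<open>[a, b]\<close>, are represented by total functions on the
  reals; the values outside these sets are never used.
\<close>

definition phi_function :: "(real \<Rightarrow> real) \<Rightarrow> bool" where
  "phi_function \<phi> \<longleftrightarrow>
     \<phi> 0 = 0 \<and> (\<forall>u>0. \<phi> u > 0) \<and> continuous_on {0..} \<phi> \<and> mono_on {0..} \<phi> \<and>
     filterlim \<phi> at_top at_top"

definition modular :: "(real \<Rightarrow> real) \<Rightarrow> real \<Rightarrow> real \<Rightarrow> (real \<Rightarrow> real) \<Rightarrow> ennreal" where
  "modular \<phi> a b f = (\<integral>\<^sup>+ x. ennreal (\<phi> \<bar>f x\<bar>) \<partial>lebesgue_on {a..b})"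

definition Orlicz_space :: "(real \<Rightarrow> real) \<Rightarrow> real \<Rightarrow> real \<Rightarrow> (real \<Rightarrow> real) set" where
  "Orlicz_space \<phi> a b =
     {f \<in> borel_measurable (lebesgue_on {a..b}). \<exists>l>0. modular \<phi> a b (\<lambda>x. l * f x) < \<infinity>}"

definition Orlicz_plus :: "(real \<Rightarrow> real) \<Rightarrow> real \<Rightarrow> real \<Rightarrow> (real \<Rightarrow> real) set" where
  "Orlicz_plus \<phi> a b = {f \<in> Orlicz_space \<phi> a b. \<forall>x\<in>{a..b}. 0 \<le> f x}"

definition sigmoidal :: "(real \<Rightarrow> real) \<Rightarrow> bool" where
  "sigmoidal \<sigma> \<longleftrightarrow>
     \<sigma> \<in> borel_measurable lebesgue \<and> (\<sigma> \<longlongrightarrow> 0) at_bot \<and> (\<sigma> \<longlongrightarrow> 1) at_top"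

definition phi_sigma :: "(real \<Rightarrow> real) \<Rightarrow> real \<Rightarrow> real" where
  "phi_sigma \<sigma> x = 1/2 * (\<sigma> (x + 1) - \<sigma> (x - 1))"

definition norm1_phi_sigma :: "(real \<Rightarrow> real) \<Rightarrow> real" where
  "norm1_phi_sigma \<sigma> = (LINT y|lebesgue. phi_sigma \<sigma> y)"

definition Sigma1 :: "(real \<Rightarrow> real) \<Rightarrow> bool" where
  "Sigma1 \<sigma> \<longleftrightarrow> (\<forall>x. \<sigma> (- x) - 1/2 = - (\<sigma> x - 1/2))"

definition Sigma2 :: "(real \<Rightarrow> real) \<Rightarrow> bool" where
  "Sigma2 \<sigma> \<longleftrightarrow> mono_on {..<0} (phi_sigma \<sigma>) \<and> antimono_on {0..} (phi_sigma \<sigma>)"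

definition Sigma3 :: "(real \<Rightarrow> real) \<Rightarrow> real \<Rightarrow> bool" where
  "Sigma3 \<sigma> \<alpha> \<longleftrightarrow> \<sigma> \<in> O[at_bot](\<lambda>x. \<bar>x\<bar> powr (- \<alpha>))"

definition index_set :: "real \<Rightarrow> real \<Rightarrow> nat \<Rightarrow> int set" where
  "index_set a b n = {\<lceil>real n * a\<rceil> .. \<lfloor>real n * b\<rfloor> - 1}"

text \<open>
  The suprema below are the conventional ones as soon as the (always finite) index set is
  non-empty, which is the case for all sufficiently large \<open>n\<close> if \<open>a < b\<close>.
\<close>

definition kantorovich_mp ::
  "(real \<Rightarrow> real) \<Rightarrow> real \<Rightarrow> real \<Rightarrow> nat \<Rightarrow> (real \<Rightarrow> real) \<Rightarrow> real \<Rightarrow> real" where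
  "kantorovich_mp \<sigma> a b n f x =
     (SUP k\<in>index_set a b n.
        (real n * (LINT u:{of_int k / real n .. (of_int k + 1) / real n}|lebesgue. f u)) *
        phi_sigma \<sigma> (real n * x - of_int k)) /
     (SUP k\<in>index_set a b n. phi_sigma \<sigma> (real n * x - of_int k))"

text \<open>Derivatives on \<open>[a, b]\<close> are one-sided at the endpoints.\<close>

definition deriv_on :: "real \<Rightarrow> real \<Rightarrow> (real \<Rightarrow> real) \<Rightarrow> real \<Rightarrow> real" where
  "deriv_on a b g x = vector_derivative g (at x within {a..b})"

definition C1_plus :: "real \<Rightarrow> real \<Rightarrow> (real \<Rightarrow> real) set" where
  "C1_plus a b =
     {g. (\<forall>x\<in>{a..b}. 0 \<le> g x) \<and> g differentiable_on {a..b} \<and>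
         continuous_on {a..b} (deriv_on a b g)}"

definition sup_norm_on :: "real \<Rightarrow> real \<Rightarrow> (real \<Rightarrow> real) \<Rightarrow> real" where
  "sup_norm_on a b h = (SUP x\<in>{a..b}. \<bar>h x\<bar>)"

definition K_functional ::
  "(real \<Rightarrow> real) \<Rightarrow> real \<Rightarrow> real \<Rightarrow> (real \<Rightarrow> real) \<Rightarrow> real \<Rightarrow> real \<Rightarrow> ennreal" where
  "K_functional \<phi> a b f l \<delta> =
     (INF g\<in>C1_plus a b.
        modular \<phi> a b (\<lambda>x. l * (f x - g x)) +
        ennreal (\<delta> * \<phi> (sup_norm_on a b (deriv_on a b g))))"

end

theory Submission
  imports Defs
begin

text \<open>
  The estimate is an interpolation argument: for every \<open>g\<close> in \<open>C1_plus a b\<close>, the error splits as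
  \<open>K f - f = (K f - g) + (g - f)\<close>, where \<open>K f\<close> is the operator applied to \<open>f\<close>. The parameters are
  \<open>lam0 = 1\<close> and \<open>lam1 = p / (3 (N + 1))\<close> with \<open>p = phi_sigma \<sigma> 2\<close> and \<open>N = norm1_phi_sigma \<sigma>\<close>.

  At a point \<open>x\<close>, the number \<open>g x \<ge> 0\<close> is itself the max-product mean of the constant \<open>g x\<close>.
  Comparing the two suprema term by term shows that \<open>\<bar>K f x - g x\<bar>\<close> is controlled by a single index \<open>k\<close>:
  it is at most \<open>\<bar>A k - g x\<bar> w k / p\<close>, with \<open>A k\<close> the mean of \<open>f\<close> over the cell of \<open>k\<close>,
  \<open>w k = phi_sigma \<sigma> (n x - k)\<close>, and \<open>p\<close> a lower bound for the largest weight, since some node is at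
  distance at most 2 from \<open>n x\<close>. This is \<open>weighted_max_quotient_diff\<close>. As \<open>g\<close> is Lipschitz with constant
  \<open>G = \<parallel>g'\<parallel>\<close>, \<open>\<bar>A k - g x\<bar>\<close> is at most the mean of \<open>\<bar>f - g\<bar>\<close> over the cell plus
  \<open>G (\<bar>n x - k\<bar> + 1) / n\<close> (\<open>kantorovich_mp_near_C1\<close>).

  Since \<open>phi_sigma \<sigma>\<close> is even and decreasing on \<open>[0, \<infinity>)\<close>, \<open>\<bar>y\<bar> phi_sigma \<sigma> y \<le> N\<close>, so the weight absorbs
  the factor \<open>\<bar>n x - k\<bar> + 1\<close>. Convexity of \<open>\<phi>\<close> now does three things: it splits the
  three error terms, it pulls the factors \<open>w k \<le> 1\<close> and \<open>1 / n \<le> 1\<close> out of \<open>\<phi>\<close>, and, by Jensen's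
  inequality, it moves the cell mean outside \<open>\<phi>\<close> (\<open>phi_kantorovich_error_le\<close>).
  Bounding the term of the one index \<open>k\<close> by the sum over all indices makes the estimate integrable in \<open>x\<close>:
  each weight has integral at most \<open>N / n\<close>, and the cells do not overlap, so the first term contributes
  at most \<open>N\<close> times the modular of \<open>f - g\<close>. The result, \<open>modular_kantorovich_error_le\<close>, holds
  for every \<open>g\<close> with a constant smaller than the required one because \<open>p \<le> 1 / 2\<close>; the infimum over \<open>g\<close>
  gives the theorem.
\<close>

section \<open>The kernel \<open>phi_sigma \<sigma>\<close>\<close>

lemma phi_sigma_even:
  assumes "Sigma1 \<sigma>"
  shows "phi_sigma \<sigma> (- x) = phi_sigma \<sigma> x"
proof -
  have "\<sigma> (- y) = 1 - \<sigma> y" for y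
    using assms unfolding Sigma1_def by (smt (verit) field_sum_of_halves)
  from this[of "x - 1"] this[of "x + 1"] show ?thesis
    by (simp add: phi_sigma_def)
qed

lemma sigmoidal_bounds:
  assumes "sigmoidal \<sigma>" "mono \<sigma>"
  shows "0 \<le> \<sigma> x" "\<sigma> x \<le> 1"
proof -
  have "eventually (\<lambda>y. \<sigma> y \<le> \<sigma> x) at_bot"
    unfolding eventually_at_bot_linorder using \<open>mono \<sigma>\<close> by (auto simp: mono_def)
  then show "0 \<le> \<sigma> x"
    using assms(1) unfolding sigmoidal_def by (intro tendsto_upperbound[of \<sigma> 0 at_bot]) auto
  have "eventually (\<lambda>y. \<sigma> x \<le> \<sigma> y) at_top"
    unfolding eventually_at_top_linorder using \<open>mono \<sigma>\<close> by (auto simp: mono_def)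
  then show "\<sigma> x \<le> 1"
    using assms(1) unfolding sigmoidal_def by (intro tendsto_lowerbound[of \<sigma> 1 at_top]) auto
qed

lemma phi_sigma_bounds:
  assumes "sigmoidal \<sigma>" "mono \<sigma>"
  shows "0 \<le> phi_sigma \<sigma> x" "phi_sigma \<sigma> x \<le> 1 / 2"
  using sigmoidal_bounds[OF assms, of "x + 1"] sigmoidal_bounds[OF assms, of "x - 1"]
    monoD[OF assms(2), of "x - 1" "x + 1"] by (auto simp: phi_sigma_def)

lemma phi_sigma_measurable:
  assumes "mono \<sigma>"
  shows "phi_sigma \<sigma> \<in> borel_measurable borel"
proof -
  have [measurable]: "\<sigma> \<in> borel_measurable borel"
    using assms by (rule borel_measurable_mono)
  show ?thesis unfolding phi_sigma_def[abs_def] by measurable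
qed

lemma mono_integrable_Icc:
  fixes g :: "real \<Rightarrow> real"
  assumes "mono g"
  shows "g integrable_on {u..v}"
  by (rule integrable_on_mono_on) (use assms in \<open>auto simp: mono_def mono_on_def\<close>)

text \<open>
  The integral telescopes: the two shifted copies of \<open>\<sigma>\<close> cancel except on an interval of length 2 at
  each end, and there \<open>0 \<le> \<sigma> \<le> 1\<close>.
\<close>

lemma integral_phi_sigma_Icc_le_1:
  assumes "sigmoidal \<sigma>" "mono \<sigma>" "1 \<le> R"
  shows "phi_sigma \<sigma> integrable_on {- R..R}" "integral {- R..R} (phi_sigma \<sigma>) \<le> 1"
proof -
  note int = mono_integrable_Icc[OF \<open>mono \<sigma>\<close>]
  have int': "(\<lambda>x. \<sigma> (x + c)) integrable_on {u..v}" for c u v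
    by (rule mono_integrable_Icc) (use \<open>mono \<sigma>\<close> in \<open>auto simp: mono_def\<close>)
  have p: "phi_sigma \<sigma> = (\<lambda>x. 1/2 * (\<sigma> (x + 1) - \<sigma> (x + (-1))))"
    by (auto simp: phi_sigma_def)
  show "phi_sigma \<sigma> integrable_on {- R..R}"
    unfolding p by (intro integrable_on_mult_right integrable_diff int')
  have "integral {- R..R} (phi_sigma \<sigma>) =
    1/2 * (integral {- R..R} (\<lambda>x. \<sigma> (x + 1)) - integral {- R..R} (\<lambda>x. \<sigma> (x + (-1))))"
    unfolding p by (simp only: integral_mult_right integral_diff[OF int' int'])
  also have "integral {- R..R} (\<lambda>x. \<sigma> (x + 1)) = integral {- R + 1..R + 1} \<sigma>"
    using integral_shift_real_ivl[of "- R + 1" 1 "R + 1" \<sigma>] by simp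
  also have "integral {- R..R} (\<lambda>x. \<sigma> (x + (-1))) = integral {- R - 1..R - 1} \<sigma>"
    using integral_shift_real_ivl[of "- R - 1" "-1" "R - 1" \<sigma>] by simp
  also have "integral {- R + 1..R + 1} \<sigma> =
      integral {- R + 1..R - 1} \<sigma> + integral {R - 1..R + 1} \<sigma>"
    by (rule Henstock_Kurzweil_Integration.integral_combine[symmetric]) (use \<open>1 \<le> R\<close> int in auto)
  also have "integral {- R - 1..R - 1} \<sigma> =
      integral {- R - 1..- R + 1} \<sigma> + integral {- R + 1..R - 1} \<sigma>"
    by (rule Henstock_Kurzweil_Integration.integral_combine[symmetric]) (use \<open>1 \<le> R\<close> int in auto)
  finally have eq: "integral {- R..R} (phi_sigma \<sigma>) =
     1/2 * (integral {R - 1..R + 1} \<sigma> - integral {- R - 1..- R + 1} \<sigma>)"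
    by simp
  have "integral {R - 1..R + 1} \<sigma> \<le> integral {R - 1..R + 1} (\<lambda>_. 1)"
    by (intro integral_le int) (auto simp: sigmoidal_bounds[OF assms(1,2)])
  moreover have "0 \<le> integral {- R - 1..- R + 1} \<sigma>"
    by (intro integral_nonneg int) (auto simp: sigmoidal_bounds[OF assms(1,2)])
  ultimately show "integral {- R..R} (phi_sigma \<sigma>) \<le> 1"
    unfolding eq by simp
qed

text \<open>
  The bound on symmetric intervals is uniform, so monotone convergence carries it to the whole line.
\<close>

lemma integrable_phi_sigma:
  assumes "sigmoidal \<sigma>" "mono \<sigma>"
  shows "integrable lebesgue (phi_sigma \<sigma>)"
proof -
  note [measurable] = phi_sigma_measurable[OF \<open>mono \<sigma>\<close>]
  note nonneg = phi_sigma_bounds(1)[OF assms]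
  let ?g = "\<lambda>(n::nat) x. ennreal (phi_sigma \<sigma> x) * indicator {- (1 + real n)..1 + real n} x"
  have inc: "incseq ?g"
    by (intro incseq_SucI le_funI) (auto simp: indicator_def)
  have lim: "(\<lambda>n. ?g n x) \<longlonglongrightarrow> ennreal (phi_sigma \<sigma> x)" for x
  proof (rule tendsto_eventually)
    obtain m :: nat where "\<bar>x\<bar> \<le> real m" using real_arch_simple by blast
    then have "?g n x = ennreal (phi_sigma \<sigma> x)" if "n \<ge> m" for n
      using that by (auto simp: indicator_def)
    then show "eventually (\<lambda>n. ?g n x = ennreal (phi_sigma \<sigma> x)) sequentially"
      by (auto simp: eventually_sequentially)
  qed
  have "(\<lambda>n. nn_integral lborel (?g n)) \<longlonglongrightarrow> nn_integral lborel (phi_sigma \<sigma>)"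
    by (intro nn_integral_LIMSEQ inc lim) auto
  moreover have "nn_integral lborel (?g n) \<le> 1" for n
    using nn_integral_has_integral_lebesgue'[OF nonneg integrable_integral
        [OF integral_phi_sigma_Icc_le_1(1)[OF assms, of "1 + real n"]]]
      integral_phi_sigma_Icc_le_1(2)[OF assms, of "1 + real n"] by simp
  ultimately have "nn_integral lborel (phi_sigma \<sigma>) \<le> 1"
    by (auto intro: LIMSEQ_le_const2)
  then have "integrable lborel (phi_sigma \<sigma>)"
    using nonneg by (intro integrableI_bounded) (auto simp: less_top[symmetric] top_unique)
  then show ?thesis by (rule integrable_completion[THEN iffD2, rotated]) auto
qed

lemma norm1_phi_sigma_nonneg:
  assumes "sigmoidal \<sigma>" "mono \<sigma>"
  shows "0 \<le> norm1_phi_sigma \<sigma>"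
  unfolding norm1_phi_sigma_def by (simp add: phi_sigma_bounds[OF assms])

lemma nn_integral_phi_sigma_dilate:
  assumes "sigmoidal \<sigma>" "mono \<sigma>" "0 < c"
  shows "(\<integral>\<^sup>+ x. ennreal (phi_sigma \<sigma> (c * x - t)) \<partial>lebesgue) = ennreal (norm1_phi_sigma \<sigma> / c)"
proof -
  have meas: "phi_sigma \<sigma> \<in> borel_measurable lebesgue"
    using integrable_phi_sigma[OF assms(1,2)] by auto
  have "ennreal (norm1_phi_sigma \<sigma>) = (\<integral>\<^sup>+ x. ennreal (phi_sigma \<sigma> x) \<partial>lebesgue)"
    unfolding norm1_phi_sigma_def
    by (rule nn_integral_eq_integral[symmetric]) (auto simp: integrable_phi_sigma phi_sigma_bounds assms)
  also have "\<dots> = ennreal c * (\<integral>\<^sup>+ x. ennreal (phi_sigma \<sigma> (- t + c * x)) \<partial>lebesgue)"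
    using meas \<open>0 < c\<close> by (subst nn_integral_real_affine_lebesgue[of _ c "- t"]) auto
  finally have *: "ennreal (norm1_phi_sigma \<sigma>) =
      ennreal c * (\<integral>\<^sup>+ x. ennreal (phi_sigma \<sigma> (c * x - t)) \<partial>lebesgue)"
    by simp
  have "ennreal (norm1_phi_sigma \<sigma> / c) = ennreal (1 / c) * ennreal (norm1_phi_sigma \<sigma>)"
    using \<open>0 < c\<close> by (simp add: ennreal_mult'[symmetric])
  also have "\<dots> = (ennreal (1 / c) * ennreal c) * (\<integral>\<^sup>+ x. ennreal (phi_sigma \<sigma> (c * x - t)) \<partial>lebesgue)"
    unfolding * by (simp add: mult.assoc)
  also have "ennreal (1 / c) * ennreal c = 1"
    using \<open>0 < c\<close> by (simp add: ennreal_mult'[symmetric])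
  finally show ?thesis by simp
qed

text \<open>
  For an even function that decreases on \<open>[0, \<infinity>)\<close>, the rectangle with base \<open>[0, \<bar>y\<bar>]\<close> and height
  \<open>phi_sigma \<sigma> y\<close> lies below the graph, so its area is at most the integral.
\<close>

lemma phi_sigma_first_moment_bounded:
  assumes "sigmoidal \<sigma>" "mono \<sigma>" "Sigma1 \<sigma>" "Sigma2 \<sigma>"
  shows "\<bar>y\<bar> * phi_sigma \<sigma> y \<le> norm1_phi_sigma \<sigma>"
proof -
  have "\<bar>y\<bar> * phi_sigma \<sigma> y = (LINT x|lebesgue. phi_sigma \<sigma> y * indicator {0..\<bar>y\<bar>} x)"
    by simp
  also have "\<dots> \<le> norm1_phi_sigma \<sigma>"
    unfolding norm1_phi_sigma_def
  proof (intro integral_mono integrable_phi_sigma assms)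
    show "integrable lebesgue (\<lambda>x. phi_sigma \<sigma> y * indicator {0..\<bar>y\<bar>} x)"
      by (intro integrable_mult_right integrable_real_indicator) auto
    fix x
    have "phi_sigma \<sigma> y = phi_sigma \<sigma> \<bar>y\<bar>"
      using phi_sigma_even[OF \<open>Sigma1 \<sigma>\<close>, of y] by (auto simp: abs_real_def)
    moreover have "phi_sigma \<sigma> \<bar>y\<bar> \<le> phi_sigma \<sigma> x" if "0 \<le> x" "x \<le> \<bar>y\<bar>"
      using \<open>Sigma2 \<sigma>\<close> that by (auto simp: Sigma2_def monotone_on_def)
    ultimately show "phi_sigma \<sigma> y * indicator {0..\<bar>y\<bar>} x \<le> phi_sigma \<sigma> x"
      using phi_sigma_bounds(1)[OF assms(1,2)] by (auto simp: indicator_def)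
  qed
  finally show ?thesis .
qed

lemma phi_sigma_ge_at_2:
  assumes "Sigma1 \<sigma>" "Sigma2 \<sigma>" "\<bar>y\<bar> \<le> 2"
  shows "phi_sigma \<sigma> 2 \<le> phi_sigma \<sigma> y"
proof -
  have "phi_sigma \<sigma> y = phi_sigma \<sigma> \<bar>y\<bar>"
    using phi_sigma_even[OF \<open>Sigma1 \<sigma>\<close>, of y] by (auto simp: abs_real_def)
  then show ?thesis
    using \<open>Sigma2 \<sigma>\<close> \<open>\<bar>y\<bar> \<le> 2\<close> by (auto simp: Sigma2_def monotone_on_def)
qed

section \<open>The max-product mean\<close>

text \<open>
  The largest node is only guaranteed to exceed \<open>n b - 2\<close>, whence the distance 2. This is why the value
  \<open>phi_sigma \<sigma> 2\<close> enters the constants: it bounds the denominator of the operator from below.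
\<close>

lemma index_set_within_2:
  assumes "real n * a \<le> y" "y \<le> real n * b" "2 \<le> real n * (b - a)"
  obtains k where "k \<in> index_set a b n" "\<bar>y - of_int k\<bar> \<le> 2"
proof -
  \<comment> \<open>The node nearest to \<open>y\<close> from above, unless the right end of the index set cuts it off.\<close>
  define k where "k = min \<lceil>y\<rceil> (\<lfloor>real n * b\<rfloor> - 1)"
  have "\<lceil>real n * a\<rceil> \<le> \<lceil>y\<rceil>" using assms by (intro ceiling_mono)
  moreover have "\<lceil>real n * a\<rceil> \<le> \<lfloor>real n * b\<rfloor> - 1"
    using assms by (simp add: algebra_simps) linarith
  ultimately have "k \<in> index_set a b n" by (auto simp: index_set_def k_def)
  moreover have "\<bar>y - of_int k\<bar> \<le> 2"
    unfolding k_def min_def using assms by (cases "\<lceil>y\<rceil> \<le> \<lfloor>real n * b\<rfloor> - 1"; simp; linarith)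
  ultimately show thesis by (rule that)
qed

text \<open>
  Write \<open>c\<close> as the quotient of \<open>SUP k. c * w k\<close> by \<open>SUP k. w k\<close>, which is possible as \<open>c \<ge> 0\<close>. If the
  numerator exceeds \<open>c\<close> times the denominator, \<open>k\<close> is an index at which the numerator is attained; otherwise it
  is one at which the denominator is attained.
\<close>

lemma weighted_max_quotient_diff:
  fixes A w :: "'i \<Rightarrow> real" and c :: real
  assumes J: "finite J" "J \<noteq> {}" and w: "\<And>k. k \<in> J \<Longrightarrow> 0 \<le> w k"
    and p: "0 < p" "j \<in> J" "p \<le> w j" and c: "0 \<le> c"
  obtains k where "k \<in> J"
    "\<bar>(SUP k\<in>J. A k * w k) / (SUP k\<in>J. w k) - c\<bar> \<le> \<bar>A k - c\<bar> * w k / p"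
proof -
  define S where "S = (SUP k\<in>J. A k * w k)"
  define M where "M = (SUP k\<in>J. w k)"
  have "S = Max ((\<lambda>k. A k * w k) ` J)" "M = Max (w ` J)"
    unfolding S_def M_def using J by (auto intro!: cSup_eq_Max)
  then have Sin: "S \<in> (\<lambda>k. A k * w k) ` J" and Min: "M \<in> w ` J"
    and SM: "\<And>k. k \<in> J \<Longrightarrow> A k * w k \<le> S" and M: "\<And>k. k \<in> J \<Longrightarrow> w k \<le> M"
    using J by auto
  have "p \<le> M" using M[OF p(2)] p(3) by simp
  then have "0 < M" using p(1) by simp
  have "\<exists>k\<in>J. \<bar>S - c * M\<bar> \<le> \<bar>A k - c\<bar> * w k"
  proof (cases "c * M \<le> S")
    case True
    obtain k where k: "k \<in> J" "S = A k * w k" using Sin by auto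
    have "S - c * M \<le> (A k - c) * w k"
      using mult_left_mono[OF M[OF k(1)] c] by (simp add: k(2) algebra_simps)
    also have "\<dots> \<le> \<bar>A k - c\<bar> * w k" by (intro mult_right_mono w k) simp
    finally show ?thesis using True k(1) by auto
  next
    case False
    obtain k where k: "k \<in> J" "M = w k" using Min by auto
    have "c * M - S \<le> (c - A k) * w k"
      using SM[OF k(1)] by (simp add: k(2) algebra_simps)
    also have "\<dots> \<le> \<bar>A k - c\<bar> * w k" by (intro mult_right_mono w k) simp
    finally show ?thesis using False k(1) by auto
  qed
  then obtain k where k: "k \<in> J" "\<bar>S - c * M\<bar> \<le> \<bar>A k - c\<bar> * w k" by auto
  have "S / M - c = (S - c * M) / M" using \<open>0 < M\<close> by (simp add: field_simps)
  then have "\<bar>S / M - c\<bar> = \<bar>S - c * M\<bar> / M" using \<open>0 < M\<close> by (simp add: abs_divide)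
  also have "\<dots> \<le> \<bar>A k - c\<bar> * w k / M"
    using k \<open>0 < M\<close> by (intro divide_right_mono) auto
  also have "\<dots> \<le> \<bar>A k - c\<bar> * w k / p"
    using k w \<open>0 < p\<close> \<open>p \<le> M\<close> by (intro divide_left_mono) auto
  finally show thesis using k(1) that unfolding S_def M_def by blast
qed

section \<open>Convexity of \<open>\<phi>\<close> and membership in the Orlicz space\<close>

lemma convex_scale_le:
  fixes \<phi> :: "real \<Rightarrow> real"
  assumes "convex_on {0..} \<phi>" "\<phi> 0 = 0" "0 \<le> t" "t \<le> 1" "0 \<le> u"
  shows "\<phi> (t * u) \<le> t * \<phi> u"
  using convex_onD[OF assms(1), of t 0 u] assms by simp

lemma convex_le_third_sum:
  fixes \<phi> :: "real \<Rightarrow> real"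
  assumes "convex_on {0..} \<phi>" "0 \<le> u" "0 \<le> v" "0 \<le> w"
  shows "\<phi> (u / 3 + v / 3 + w / 3) \<le> \<phi> u / 3 + \<phi> v / 3 + \<phi> w / 3"
proof -
  have "\<phi> ((1 - 2/3) *\<^sub>R u + (2/3) *\<^sub>R ((1 - 1/2) *\<^sub>R v + (1/2) *\<^sub>R w))
      \<le> (1 - 2/3) * \<phi> u + (2/3) * \<phi> ((1 - 1/2) *\<^sub>R v + (1/2) *\<^sub>R w)"
    by (rule convex_onD[OF assms(1)]) (use assms in auto)
  also have "\<phi> ((1 - 1/2) *\<^sub>R v + (1/2) *\<^sub>R w) \<le> (1 - 1/2) * \<phi> v + (1/2) * \<phi> w"
    by (rule convex_onD[OF assms(1)]) (use assms in auto)
  finally have "\<phi> ((1 - 2/3) *\<^sub>R u + (2/3) *\<^sub>R ((1 - 1/2) *\<^sub>R v + (1/2) *\<^sub>R w))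
      \<le> \<phi> u / 3 + \<phi> v / 3 + \<phi> w / 3" by (simp add: field_simps)
  also have "(1 - 2/3) *\<^sub>R u + (2/3) *\<^sub>R ((1 - 1/2) *\<^sub>R v + (1/2) *\<^sub>R w) = u / 3 + v / 3 + w / 3"
    by (simp add: field_simps)
  finally show ?thesis .
qed

text \<open>
  A supporting line of \<open>\<phi>\<close> at the mean \<open>m\<close> of \<open>h\<close>, integrated along \<open>h\<close>. At \<open>m = 0\<close>, which is
  not interior to the domain, the left side is \<open>\<phi> 0 = 0\<close>.
\<close>

lemma Jensen_Icc:
  fixes \<phi> h :: "real \<Rightarrow> real"
  assumes phi: "convex_on {0..} \<phi>" "\<phi> 0 = 0" "\<And>u. 0 \<le> u \<Longrightarrow> 0 \<le> \<phi> u"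
    and "u < v" and h: "h integrable_on {u..v}" "\<And>x. x \<in> {u..v} \<Longrightarrow> 0 \<le> h x"
    and ph: "(\<lambda>x. \<phi> (h x)) integrable_on {u..v}"
  shows "\<phi> (integral {u..v} h / (v - u)) \<le> integral {u..v} (\<lambda>x. \<phi> (h x)) / (v - u)"
proof -
  define m where "m = integral {u..v} h / (v - u)"
  have "0 \<le> integral {u..v} h" by (intro integral_nonneg h)
  then have "0 \<le> m" using \<open>u < v\<close> by (simp add: m_def)
  show ?thesis
  proof (cases "m = 0")
    case True
    have "0 \<le> integral {u..v} (\<lambda>x. \<phi> (h x))" by (intro integral_nonneg ph phi(3) h(2))
    then show ?thesis using True phi(2) \<open>u < v\<close> unfolding m_def[symmetric] by simp
  next
    case False
    then have m: "m \<in> interior {0..}" using \<open>0 \<le> m\<close> by simp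
    obtain c where c: "\<phi> m + c * (y - m) \<le> \<phi> y" if "0 \<le> y" for y
      using convex_le_Inf_differential[OF phi(1) m] by (metis atLeast_iff)
    have "integral {u..v} (\<lambda>x. (\<phi> m - c * m) + c * h x) \<le> integral {u..v} (\<lambda>x. \<phi> (h x))"
    proof (rule integral_le)
      show "(\<lambda>x. (\<phi> m - c * m) + c * h x) integrable_on {u..v}"
        using h by (intro integrable_add integrable_on_mult_right) auto
      show "(\<phi> m - c * m) + c * h x \<le> \<phi> (h x)" if "x \<in> {u..v}" for x
        using c[OF h(2)[OF that]] by (simp add: algebra_simps)
    qed (rule ph)
    also have "integral {u..v} (\<lambda>x. (\<phi> m - c * m) + c * h x)
        = (v - u) * (\<phi> m - c * m) + c * integral {u..v} h"
      using \<open>u < v\<close> h by (subst integral_add) (auto intro!: integrable_on_mult_right)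
    also have "integral {u..v} h = m * (v - u)" using \<open>u < v\<close> by (simp add: m_def)
    finally show ?thesis using \<open>u < v\<close> unfolding m_def[symmetric]
      by (simp add: field_simps)
  qed
qed

lemma phi_abs_measurable:
  assumes "phi_function \<phi>" and h: "h \<in> borel_measurable M"
  shows "(\<lambda>x. \<phi> \<bar>h x\<bar>) \<in> borel_measurable M"
proof -
  have "continuous_on UNIV (\<lambda>y. \<phi> \<bar>y\<bar>)"
    by (rule continuous_on_compose2[of "{0..}" \<phi>])
      (use assms(1) in \<open>auto simp: phi_function_def intro!: continuous_intros\<close>)
  then show ?thesis using h by (rule borel_measurable_continuous_on)
qed

text \<open>
  A convex \<open>\<phi>\<close> grows at least linearly: \<open>\<phi> u \<ge> u * \<phi> 1\<close> for \<open>u \<ge> 1\<close>. This makes the means over the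
  cells of a function in the Orlicz space meaningful.
\<close>

lemma Orlicz_space_absolutely_integrable:
  assumes phi: "phi_function \<phi>" "convex_on {0..} \<phi>" and f: "f \<in> Orlicz_space \<phi> a b"
  shows "f absolutely_integrable_on {a..b}"
proof -
  obtain l where l: "l > 0" and fin: "modular \<phi> a b (\<lambda>x. l * f x) < \<infinity>"
    and meas: "f \<in> borel_measurable (lebesgue_on {a..b})"
    using f by (auto simp: Orlicz_space_def)
  have p0: "\<phi> 0 = 0" and p1: "\<phi> 1 > 0" and pos: "\<And>u. 0 \<le> u \<Longrightarrow> 0 \<le> \<phi> u"
    using phi(1) unfolding phi_function_def by (auto simp: le_less)
  have lin: "u \<le> 1 + \<phi> u / \<phi> 1" if "0 \<le> u" for u
  proof (cases "u \<le> 1")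
    case True then show ?thesis using pos[OF that] p1 by (smt (verit) divide_nonneg_pos)
  next
    case False
    then have "\<phi> 1 \<le> 1 / u * \<phi> u"
      using convex_scale_le[OF phi(2) p0, of "1 / u" u] by simp
    then have "u \<le> \<phi> u / \<phi> 1" using False p1 by (simp add: field_simps)
    then show ?thesis by simp
  qed
  have "(\<integral>\<^sup>+ x. ennreal (norm (f x)) \<partial>lebesgue_on {a..b}) \<le>
      (\<integral>\<^sup>+ x. ennreal (1 / l) + ennreal (1 / (l * \<phi> 1)) * ennreal (\<phi> \<bar>l * f x\<bar>) \<partial>lebesgue_on {a..b})"
  proof (rule nn_integral_mono)
    fix x
    have "norm (f x) = \<bar>l * f x\<bar> / l" using l by (simp add: abs_mult)
    also have "\<dots> \<le> (1 + \<phi> \<bar>l * f x\<bar> / \<phi> 1) / l"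
      using l by (intro divide_right_mono lin) auto
    also have "\<dots> = 1 / l + 1 / (l * \<phi> 1) * \<phi> \<bar>l * f x\<bar>" using l p1 by (simp add: field_simps)
    finally show "ennreal (norm (f x)) \<le> ennreal (1 / l) + ennreal (1 / (l * \<phi> 1)) * ennreal (\<phi> \<bar>l * f x\<bar>)"
      using l p1 pos by (simp add: ennreal_mult'[symmetric] ennreal_plus[symmetric] ennreal_leI del: ennreal_plus)
  qed
  also have "\<dots> < \<infinity>"
  proof -
    have "(\<lambda>x. \<phi> \<bar>l * f x\<bar>) \<in> borel_measurable (lebesgue_on {a..b})"
      using meas by (intro phi_abs_measurable[OF phi(1)]) simp
    then show ?thesis
      using fin by (subst nn_integral_add) (auto simp: nn_integral_cmult modular_def ennreal_mult_less_top emeasure_restrict_space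
          emeasure_lborel_Icc_eq)
  qed
  finally have "integrable (lebesgue_on {a..b}) f"
    using meas by (intro integrableI_bounded) auto
  then show ?thesis
    by (simp add: integrable_restrict_space set_integrable_def)
qed

section \<open>Cells of the operator\<close>

lemma integral_index_set_cells_le:
  assumes h: "h integrable_on {a..b}" "\<And>x. x \<in> {a..b} \<Longrightarrow> 0 \<le> h x" and n: "0 < n"
  shows "(\<Sum>k\<in>index_set a b n. integral {of_int k / real n..(of_int k + 1) / real n} h)
    \<le> integral {a..b} (h :: real \<Rightarrow> real)"
proof -
  define c where "c = \<lceil>real n * a\<rceil>"
  \<comment> \<open>Consecutive cells share an end point, so their integrals add up to the integral over a longer
    interval; the induction starts at the empty sum, \<open>d = c - 1\<close>.\<close>
  have chain: "of_int (d + 1) / real n \<le> b \<longrightarrow>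
      (\<Sum>k\<in>{c..d}. integral {of_int k / real n..(of_int k + 1) / real n} h) =
      integral {of_int c / real n..of_int (d + 1) / real n} h" if "c - 1 \<le> d" for d
    using that
  proof (induction d rule: int_ge_induct)
    case base
    then show ?case by simp
  next
    case (step d)
    show ?case
    proof
      assume le: "of_int (d + 1 + 1) / real n \<le> b"
      have "a \<le> of_int c / real n" using n by (simp add: c_def field_simps)
      moreover have 1: "of_int c / real n \<le> of_int (d + 1) / real n"
        and 2: "of_int (d + 1) / real n \<le> of_int (d + 1 + 1) / real n"
        using n step.hyps by (auto simp: divide_right_mono)
      ultimately have int: "h integrable_on {of_int c / real n..of_int (d + 1 + 1) / real n}"
        using le by (intro integrable_on_subinterval[OF h(1)]) auto
      have "{c..d + 1} = insert (d + 1) {c..d}" using step.hyps by auto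
      then show "(\<Sum>k\<in>{c..d + 1}. integral {of_int k / real n..(of_int k + 1) / real n} h) =
        integral {of_int c / real n..of_int (d + 1 + 1) / real n} h"
        using step.IH le 2 Henstock_Kurzweil_Integration.integral_combine[OF 1 2 int]
        by (simp add: add.commute)
    qed
  qed
  show ?thesis
  proof (cases "c \<le> \<lfloor>real n * b\<rfloor> - 1")
    case True
    define d where "d = \<lfloor>real n * b\<rfloor> - 1"
    have d: "of_int (d + 1) / real n \<le> b" using n by (simp add: d_def field_simps)
    have c: "a \<le> of_int c / real n" using n by (simp add: c_def field_simps)
    have sub: "{of_int c / real n..of_int (d + 1) / real n} \<subseteq> {a..b}" using c d by auto
    have "(\<Sum>k\<in>index_set a b n. integral {of_int k / real n..(of_int k + 1) / real n} h) =
        integral {of_int c / real n..of_int (d + 1) / real n} h"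
      using chain[of d] d True by (simp add: index_set_def c_def d_def)
    also have "\<dots> \<le> integral {a..b} h"
      by (rule integral_subset_le[OF sub integrable_on_subinterval[OF h(1) sub] h(1)])
        (use h(2) in auto)
    finally show ?thesis .
  next
    case False
    then have "index_set a b n = {}" by (simp add: index_set_def c_def)
    then show ?thesis using integral_nonneg[OF h(1)] h(2) by simp
  qed
qed

lemma cell_subset:
  assumes "k \<in> index_set a b n" "0 < n"
  shows "{of_int k / real n..(of_int k + 1) / real n} \<subseteq> {a..b}"
proof -
  have "real n * a \<le> of_int k" "of_int k + 1 \<le> real n * b"
    using assms by (simp_all add: index_set_def) linarith+
  then have "a \<le> of_int k / real n" "(of_int k + 1) / real n \<le> b"
    using assms(2) by (auto simp: field_simps)
  then show ?thesis by auto
qed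

section \<open>Pointwise error against a \<open>C1\<close> function\<close>

lemma C1_plus_Lipschitz:
  assumes "a < b" "g \<in> C1_plus a b"
  shows "0 \<le> sup_norm_on a b (deriv_on a b g)"
    and "continuous_on {a..b} g"
    and "\<lbrakk>x \<in> {a..b}; y \<in> {a..b}\<rbrakk> \<Longrightarrow>
      \<bar>g x - g y\<bar> \<le> sup_norm_on a b (deriv_on a b g) * \<bar>x - y\<bar>"
proof -
  define G where "G = sup_norm_on a b (deriv_on a b g)"
  have diff: "g differentiable_on {a..b}" and cont: "continuous_on {a..b} (deriv_on a b g)"
    using assms(2) by (auto simp: C1_plus_def)
  have "compact ((\<lambda>x. \<bar>deriv_on a b g x\<bar>) ` {a..b})"
    by (intro compact_continuous_image continuous_intros cont) auto
  then have "bdd_above ((\<lambda>x. \<bar>deriv_on a b g x\<bar>) ` {a..b})"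
    by (intro bounded_imp_bdd_above compact_imp_bounded)
  then have G: "\<bar>deriv_on a b g x\<bar> \<le> G" if "x \<in> {a..b}" for x
    unfolding G_def sup_norm_on_def using that by (intro cSUP_upper)
  show "0 \<le> sup_norm_on a b (deriv_on a b g)"
    using G[of a] \<open>a < b\<close> unfolding G_def[symmetric] by simp
  show "continuous_on {a..b} g" using diff by (rule differentiable_imp_continuous_on)
  have der: "(g has_vector_derivative deriv_on a b g x) (at x within {a..b})" if "x \<in> {a..b}" for x
    using diff that unfolding deriv_on_def differentiable_on_def
    by (simp add: vector_derivative_works)
  show "\<bar>g x - g y\<bar> \<le> sup_norm_on a b (deriv_on a b g) * \<bar>x - y\<bar>"
    if "x \<in> {a..b}" "y \<in> {a..b}"
  proof -
    have "norm (g x - g y) \<le> G * norm (x - y)"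
      using that by (intro field_differentiable_bound[of "{a..b}" g "deriv_on a b g"])
        (auto simp: has_real_derivative_iff_has_vector_derivative der G)
    then show ?thesis by (simp add: G_def)
  qed
qed

text \<open>
  On the cell of \<open>k\<close>, \<open>\<bar>u - x\<bar> \<le> (\<bar>n x - k\<bar> + 1) / n\<close>, so the Lipschitz bound replaces \<open>g x\<close> by
  \<open>g u\<close> at the stated cost. The factor \<open>\<bar>n x - k\<bar>\<close> is kept next to the weight, which compensates it.
\<close>

lemma kantorovich_mp_near_C1:
  assumes \<sigma>: "sigmoidal \<sigma>" "mono \<sigma>" "Sigma1 \<sigma>" "Sigma2 \<sigma>" "0 < phi_sigma \<sigma> 2"
    and f: "f absolutely_integrable_on {a..b}" and g: "g \<in> C1_plus a b" and "a < b"
    and n: "0 < n" "2 \<le> real n * (b - a)" and x: "x \<in> {a..b}"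
  obtains k where "k \<in> index_set a b n"
    "\<bar>kantorovich_mp \<sigma> a b n f x - g x\<bar> \<le>
      (real n * integral {of_int k / real n..(of_int k + 1) / real n} (\<lambda>u. \<bar>f u - g u\<bar>) +
       sup_norm_on a b (deriv_on a b g) * (\<bar>real n * x - of_int k\<bar> + 1) / real n) *
      phi_sigma \<sigma> (real n * x - of_int k) / phi_sigma \<sigma> 2"
proof -
  define G where "G = sup_norm_on a b (deriv_on a b g)"
  define I where "I k = {of_int k / real n..(of_int k + 1) / real n}" for k :: int
  define w where "w k = phi_sigma \<sigma> (real n * x - of_int k)" for k :: int
  define av where "av k = real n * (LINT u:I k|lebesgue. f u)" for k :: int
  note lip = C1_plus_Lipschitz[OF \<open>a < b\<close> g, folded G_def]
  obtain j where j: "j \<in> index_set a b n" "\<bar>real n * x - of_int j\<bar> \<le> 2"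
    using x n by (auto intro: index_set_within_2[of n a "real n * x" b])
  obtain k where k: "k \<in> index_set a b n"
    "\<bar>(SUP k\<in>index_set a b n. av k * w k) / (SUP k\<in>index_set a b n. w k) - g x\<bar>
      \<le> \<bar>av k - g x\<bar> * w k / phi_sigma \<sigma> 2"
  proof (rule weighted_max_quotient_diff)
    show "finite (index_set a b n)" "index_set a b n \<noteq> {}"
      using j(1) by (auto simp: index_set_def)
    show "0 \<le> w k" for k unfolding w_def by (rule phi_sigma_bounds[OF \<sigma>(1,2)])
    show "phi_sigma \<sigma> 2 \<le> w j" unfolding w_def by (rule phi_sigma_ge_at_2[OF \<sigma>(3,4) j(2)])
    show "0 \<le> g x" using g x by (simp add: C1_plus_def)
  qed (use \<sigma> j in auto)
  have sub: "I k \<subseteq> {a..b}" unfolding I_def by (rule cell_subset[OF k(1) n(1)])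
  have Iint: "integral (I k) (\<lambda>_. c) = c / real n" for c :: real
    using n by (simp add: I_def diff_divide_distrib[symmetric] divide_right_mono)
  have f_int: "f absolutely_integrable_on I k"
    by (rule set_integrable_subset[OF f _ sub]) (simp add: I_def)
  have g_int: "g absolutely_integrable_on I k"
    unfolding I_def
    by (intro absolutely_integrable_continuous_real continuous_on_subset[OF lip(2)])
      (use sub in \<open>simp add: I_def\<close>)
  have fg_int: "(\<lambda>u. \<bar>f u - g u\<bar>) integrable_on I k"
    using absolutely_integrable_norm[OF set_integral_diff(1)[OF f_int g_int]]
    by (auto simp: o_def intro: set_lebesgue_integral_eq_integral(1))
  have const: "(\<lambda>_. c) integrable_on I k" for c :: real
    unfolding I_def by (rule integrable_const_ivl)
  note f_int' = set_lebesgue_integral_eq_integral[OF f_int]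
  define D where "D = G * (\<bar>real n * x - of_int k\<bar> + 1) / real n"
  have "norm (integral (I k) (\<lambda>u. f u - g x)) \<le> integral (I k) (\<lambda>u. \<bar>f u - g u\<bar> + D)"
  proof (rule integral_norm_bound_integral)
    show "(\<lambda>u. f u - g x) integrable_on I k" by (intro integrable_diff f_int' const)
    show "(\<lambda>u. \<bar>f u - g u\<bar> + D) integrable_on I k" by (intro integrable_add fg_int const)
    fix u assume u: "u \<in> I k"
    then have "of_int k \<le> real n * u" "real n * u \<le> of_int k + 1"
      using n by (auto simp: I_def field_simps)
    then have "\<bar>real n * u - real n * x\<bar> \<le> \<bar>real n * x - of_int k\<bar> + 1" by linarith
    moreover have "\<bar>real n * u - real n * x\<bar> = \<bar>u - x\<bar> * real n"
      by (simp add: right_diff_distrib[symmetric] abs_mult)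
    ultimately have "\<bar>u - x\<bar> \<le> (\<bar>real n * x - of_int k\<bar> + 1) / real n"
      using n by (simp add: pos_le_divide_eq)
    then have "G * \<bar>u - x\<bar> \<le> D"
      unfolding D_def using mult_left_mono[OF _ lip(1)] by fastforce
    then have "\<bar>g u - g x\<bar> \<le> D" using lip(3)[of u x] u sub x by (meson order_trans subsetD)
    then show "norm (f u - g x) \<le> \<bar>f u - g u\<bar> + D" by simp
  qed
  also have "\<dots> = integral (I k) (\<lambda>u. \<bar>f u - g u\<bar>) + D / real n"
    by (simp add: integral_add[OF fg_int const] Iint)
  finally have *: "\<bar>integral (I k) f - g x / real n\<bar> \<le> integral (I k) (\<lambda>u. \<bar>f u - g u\<bar>) + D / real n"
    by (simp add: integral_diff[OF f_int'(1) const] Iint)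
  have "\<bar>av k - g x\<bar> = real n * \<bar>integral (I k) f - g x / real n\<bar>"
    using n by (simp add: av_def f_int'(2) abs_mult_pos' right_diff_distrib)
  also have "\<dots> \<le> real n * (integral (I k) (\<lambda>u. \<bar>f u - g u\<bar>) + D / real n)"
    by (intro mult_left_mono *) simp
  also have "\<dots> = real n * integral (I k) (\<lambda>u. \<bar>f u - g u\<bar>) + D" using n by (simp add: distrib_left)
  finally have "\<bar>av k - g x\<bar> * w k / phi_sigma \<sigma> 2 \<le>
      (real n * integral (I k) (\<lambda>u. \<bar>f u - g u\<bar>) + D) * w k / phi_sigma \<sigma> 2"
    using \<sigma>(5) phi_sigma_bounds(1)[OF \<sigma>(1,2)]
    by (intro divide_right_mono mult_right_mono) (auto simp: w_def)
  moreover have "kantorovich_mp \<sigma> a b n f x =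
     (SUP k\<in>index_set a b n. av k * w k) / (SUP k\<in>index_set a b n. w k)"
    by (simp add: kantorovich_mp_def av_def w_def I_def)
  ultimately show thesis using k that[of k] unfolding D_def G_def w_def I_def by simp
qed

text \<open>
  The factor \<open>1 / 3\<close> in \<open>l\<close> turns the three error terms into a convex combination, and the factor
  \<open>1 / (N + 1)\<close> makes the coefficient of \<open>G / n\<close> at most 1. The single
  index of the preceding bound depends on \<open>x\<close>; replacing its term by the sum over all
  indices removes this dependence.
\<close>

lemma phi_kantorovich_error_le:
  fixes \<phi> \<sigma> f g :: "real \<Rightarrow> real"
  defines "l \<equiv> phi_sigma \<sigma> 2 / (3 * (norm1_phi_sigma \<sigma> + 1))"
  defines "h \<equiv> \<lambda>u. \<phi> \<bar>f u - g u\<bar>"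
  assumes phi: "phi_function \<phi>" "convex_on {0..} \<phi>"
    and \<sigma>: "sigmoidal \<sigma>" "mono \<sigma>" "Sigma1 \<sigma>" "Sigma2 \<sigma>" "0 < phi_sigma \<sigma> 2"
    and f: "f absolutely_integrable_on {a..b}" and g: "g \<in> C1_plus a b" and "a < b"
    and h: "h integrable_on {a..b}"
    and n: "0 < n" "2 \<le> real n * (b - a)" and x: "x \<in> {a..b}"
  shows "\<phi> \<bar>l * (kantorovich_mp \<sigma> a b n f x - f x)\<bar> \<le> 1 / 3 *
    ((\<Sum>k\<in>index_set a b n. phi_sigma \<sigma> (real n * x - of_int k) *
        (real n * integral {of_int k / real n..(of_int k + 1) / real n} h)) +
     \<phi> (sup_norm_on a b (deriv_on a b g)) / real n + h x)"
proof -
  define N where "N = norm1_phi_sigma \<sigma>"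
  define p where "p = phi_sigma \<sigma> 2"
  define G where "G = sup_norm_on a b (deriv_on a b g)"
  define I where "I k = {of_int k / real n..(of_int k + 1) / real n}" for k :: int
  define w where "w k = phi_sigma \<sigma> (real n * x - of_int k)" for k :: int
  have N: "0 \<le> N" unfolding N_def by (rule norm1_phi_sigma_nonneg[OF \<sigma>(1,2)])
  have p: "0 < p" "p \<le> 1 / 2" using \<sigma>(5) phi_sigma_bounds[OF \<sigma>(1,2)] by (auto simp: p_def)
  have w: "0 \<le> w k" "w k \<le> 1 / 2" for k using phi_sigma_bounds[OF \<sigma>(1,2)] by (auto simp: w_def)
  note lip = C1_plus_Lipschitz[OF \<open>a < b\<close> g, folded G_def]
  have p0: "\<phi> 0 = 0" and mono: "\<And>u v. 0 \<le> u \<Longrightarrow> u \<le> v \<Longrightarrow> \<phi> u \<le> \<phi> v"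
    using phi(1) unfolding phi_function_def by (auto simp: mono_on_def)
  have pos: "\<And>u. 0 \<le> u \<Longrightarrow> 0 \<le> \<phi> u" using mono[of 0] p0 by auto
  obtain k where k: "k \<in> index_set a b n"
    and err: "\<bar>kantorovich_mp \<sigma> a b n f x - g x\<bar> \<le>
      (real n * integral (I k) (\<lambda>u. \<bar>f u - g u\<bar>) + G * (\<bar>real n * x - of_int k\<bar> + 1) / real n) * w k / p"
    using kantorovich_mp_near_C1[OF \<sigma> f g \<open>a < b\<close> n x] unfolding I_def w_def G_def p_def by blast
  define m where "m = real n * integral (I k) (\<lambda>u. \<bar>f u - g u\<bar>)"
  have Isub: "I k \<subseteq> {a..b}" unfolding I_def by (rule cell_subset[OF k n(1)])
  have len: "(of_int k + 1) / real n - of_int k / real n = 1 / real n" by (simp add: add_divide_distrib)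
  have g_int: "g absolutely_integrable_on {a..b}"
    by (rule absolutely_integrable_continuous_real[OF lip(2)])
  have "(\<lambda>u. \<bar>f u - g u\<bar>) integrable_on {a..b}"
    using absolutely_integrable_norm[OF set_integral_diff(1)[OF f g_int]]
    by (auto simp: o_def intro: set_lebesgue_integral_eq_integral(1))
  then have fg_int: "(\<lambda>u. \<bar>f u - g u\<bar>) integrable_on I k"
    using Isub unfolding I_def by (rule integrable_on_subinterval)
  have h_int: "h integrable_on I k'" if "k' \<in> index_set a b n" for k'
    using cell_subset[OF that n(1)] unfolding I_def by (rule integrable_on_subinterval[OF h])
  have m0: "0 \<le> m" unfolding m_def by (intro mult_nonneg_nonneg integral_nonneg fg_int) auto
  have "\<phi> m \<le> real n * integral (I k) h"
    using Jensen_Icc[OF phi(2) p0 pos, of "of_int k / real n" "(of_int k + 1) / real n" "\<lambda>u. \<bar>f u - g u\<bar>"]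
      fg_int h_int[OF k] n unfolding len h_def I_def m_def
    by (simp add: divide_strict_right_mono mult.commute)
  then have "w k * \<phi> m \<le> w k * (real n * integral (I k) h)" by (intro mult_left_mono w)
  also have "\<dots> \<le> (\<Sum>k\<in>index_set a b n. w k * (real n * integral (I k) h))"
    by (rule member_le_sum[OF k])
      (auto simp: index_set_def h_def intro!: mult_nonneg_nonneg w integral_nonneg h_int[unfolded h_def] pos)
  finally have jensen: "w k * \<phi> m \<le> (\<Sum>k\<in>index_set a b n. w k * (real n * integral (I k) h))" .
  \<comment> \<open>The coefficients of the three error terms, each at most 1.\<close>
  define t where "t = w k / (N + 1)"
  define s where "s = (\<bar>real n * x - of_int k\<bar> + 1) * w k / (N + 1)"
  define r where "r = p / (N + 1)"
  have t: "0 \<le> t" "t \<le> w k" "t \<le> 1"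
    using w[of k] N by (auto simp: t_def divide_le_eq mult_le_cancel_left1)
  have r: "0 \<le> r" "r \<le> 1" using p N by (auto simp: r_def divide_le_eq)
  have "\<bar>real n * x - of_int k\<bar> * w k \<le> N"
    unfolding N_def w_def by (rule phi_sigma_first_moment_bounded[OF \<sigma>(1-4)])
  then have s: "0 \<le> s" "s \<le> 1" using w[of k] N by (auto simp: s_def divide_le_eq distrib_right)
  have l: "l = r / 3" by (simp add: l_def r_def p_def N_def)
  have "\<bar>l * (kantorovich_mp \<sigma> a b n f x - f x)\<bar> \<le>
      l * (\<bar>kantorovich_mp \<sigma> a b n f x - g x\<bar> + \<bar>f x - g x\<bar>)"
    unfolding abs_mult using r by (intro mult_mono) (auto simp: l)
  also have "\<dots> \<le> l * ((m + G * (\<bar>real n * x - of_int k\<bar> + 1) / real n) * w k / p + \<bar>f x - g x\<bar>)"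
    using err r by (intro mult_left_mono) (auto simp: l m_def)
  also have "\<dots> = (t * m) / 3 + (s * (G / real n)) / 3 + (r * \<bar>f x - g x\<bar>) / 3"
  proof -
    have lp: "l / p = 1 / (3 * (N + 1))" using p by (simp add: l r_def)
    have 1: "t * m / 3 = l / p * (m * w k)" unfolding lp by (simp add: t_def mult.commute)
    have "y * z / K * (G / v) / 3 = 1 / (3 * K) * (G * y / v * z)" for y z v K :: real
      by (simp add: mult_ac)
    then have 2: "s * (G / real n) / 3 =
        l / p * (G * (\<bar>real n * x - of_int k\<bar> + 1) / real n * w k)"
      unfolding lp s_def .
    have 3: "r * d / 3 = l * d" for d by (simp add: l)
    have "l * ((m + D) * w k / p + d) = l / p * (m * w k) + l / p * (D * w k) + l * d" for D d
      by (simp add: distrib_left distrib_right add_divide_distrib)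
    then show ?thesis by (simp only: 1 2 3)
  qed
  finally have "\<phi> \<bar>l * (kantorovich_mp \<sigma> a b n f x - f x)\<bar> \<le>
      \<phi> ((t * m) / 3 + (s * (G / real n)) / 3 + (r * \<bar>f x - g x\<bar>) / 3)"
    by (intro mono) auto
  also have "\<dots> \<le> \<phi> (t * m) / 3 + \<phi> (s * (G / real n)) / 3 + \<phi> (r * \<bar>f x - g x\<bar>) / 3"
    using t s r m0 lip(1) by (intro convex_le_third_sum phi) auto
  also have "\<phi> (t * m) \<le> w k * \<phi> m"
  proof -
    have "\<phi> (t * m) \<le> t * \<phi> m" by (intro convex_scale_le phi p0 t m0)
    also have "\<dots> \<le> w k * \<phi> m" by (intro mult_right_mono t pos m0)
    finally show ?thesis .
  qed
  also have "w k * \<phi> m \<le> (\<Sum>k\<in>index_set a b n. w k * (real n * integral (I k) h))"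
    by (rule jensen)
  also have "\<phi> (s * (G / real n)) \<le> \<phi> G / real n"
  proof -
    have "\<phi> (s * (G / real n)) \<le> \<phi> (1 / real n * G)"
      using s lip(1) mult_right_mono[of s 1 "G / real n"] by (intro mono) auto
    also have "\<dots> \<le> 1 / real n * \<phi> G"
      using n lip(1) by (intro convex_scale_le phi p0) auto
    finally show ?thesis by simp
  qed
  also have "\<phi> (r * \<bar>f x - g x\<bar>) \<le> h x"
    unfolding h_def using r by (intro mono) (auto intro: mult_left_le_one_le)
  finally show ?thesis
    unfolding w_def I_def G_def by (simp add: field_simps divide_right_mono)
qed

section \<open>Modular estimate\<close>

text \<open>
  Integrating the pointwise bound: the weights integrate to at most \<open>N / n\<close> each, which cancels the factor
  \<open>n\<close> of the cell means and leaves \<open>N\<close> times the integral of \<open>\<phi> \<bar>f - g\<bar>\<close> over the cells. Splitting off the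
  case of an infinite modular allows real-valued integrals in the other one.
\<close>

lemma modular_kantorovich_error_le:
  fixes \<phi> \<sigma> f g :: "real \<Rightarrow> real"
  defines "l \<equiv> phi_sigma \<sigma> 2 / (3 * (norm1_phi_sigma \<sigma> + 1))"
  assumes phi: "phi_function \<phi>" "convex_on {0..} \<phi>"
    and \<sigma>: "sigmoidal \<sigma>" "mono \<sigma>" "Sigma1 \<sigma>" "Sigma2 \<sigma>" "0 < phi_sigma \<sigma> 2"
    and f: "f absolutely_integrable_on {a..b}" and g: "g \<in> C1_plus a b" and "a < b"
    and n: "0 < n" "2 \<le> real n * (b - a)"
  shows "modular \<phi> a b (\<lambda>x. l * (kantorovich_mp \<sigma> a b n f x - f x)) \<le>
    ennreal ((norm1_phi_sigma \<sigma> + 1) / 3) * modular \<phi> a b (\<lambda>x. f x - g x) +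
    ennreal ((b - a) / 3 * (\<phi> (sup_norm_on a b (deriv_on a b g)) / real n))"
proof (cases "modular \<phi> a b (\<lambda>x. f x - g x) = \<infinity>")
  case True
  then show ?thesis using norm1_phi_sigma_nonneg[OF \<sigma>(1,2)] by (simp add: ennreal_mult_top)
next
  case False
  define h where "h = (\<lambda>u. \<phi> \<bar>f u - g u\<bar>)"
  define N where "N = norm1_phi_sigma \<sigma>"
  define G where "G = sup_norm_on a b (deriv_on a b g)"
  define J where "J = index_set a b n"
  define c where "c k = real n * integral {of_int k / real n..(of_int k + 1) / real n} h" for k :: int
  define L where "L = lebesgue_on {a..b}"
  have N: "0 \<le> N" unfolding N_def by (rule norm1_phi_sigma_nonneg[OF \<sigma>(1,2)])
  note lip = C1_plus_Lipschitz[OF \<open>a < b\<close> g, folded G_def]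
  have pos: "0 \<le> \<phi> u" if "0 \<le> u" for u
    using phi(1) that unfolding phi_function_def by (cases "u = 0") (auto simp: less_imp_le)
  have h0: "0 \<le> h u" for u by (simp add: h_def pos)
  have w0: "0 \<le> phi_sigma \<sigma> u" for u by (rule phi_sigma_bounds[OF \<sigma>(1,2)])
  have "g absolutely_integrable_on {a..b}"
    by (rule absolutely_integrable_continuous_real[OF lip(2)])
  then have "integrable L (\<lambda>u. f u - g u)"
    using set_integral_diff(1)[OF f] by (simp add: L_def integrable_restrict_space set_integrable_def)
  then have hm [measurable]: "h \<in> borel_measurable L"
    unfolding h_def by (intro phi_abs_measurable[OF phi(1)]) auto
  have mod: "modular \<phi> a b (\<lambda>x. f x - g x) = (\<integral>\<^sup>+ x. ennreal (h x) \<partial>L)"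
    by (simp add: modular_def h_def L_def)
  have hL: "integrable L h"
    using False h0 hm by (intro integrableI_bounded) (auto simp: mod less_top)
  then have h_int: "h integrable_on {a..b}"
    unfolding L_def by (rule integrable_on_lebesgue_on) simp
  have modI: "modular \<phi> a b (\<lambda>x. f x - g x) = ennreal (integral {a..b} h)"
    unfolding mod using hL lebesgue_integral_eq_integral[of "{a..b}" h] h0
    by (simp add: nn_integral_eq_integral L_def)
  have c0: "0 \<le> c k" if "k \<in> J" for k
    unfolding c_def using cell_subset[of k a b n] that n(1) h0
    by (intro mult_nonneg_nonneg integral_nonneg integrable_on_subinterval[OF h_int]) (auto simp: J_def)
  have [measurable]: "(\<lambda>x. phi_sigma \<sigma> (real n * x - of_int k)) \<in> borel_measurable L" for k :: int
  proof -
    have "(\<lambda>x. phi_sigma \<sigma> (real n * x - of_int k)) \<in> borel_measurable borel"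
      using phi_sigma_measurable[OF \<sigma>(2)] by (rule measurable_compose[rotated]) simp
    then show ?thesis unfolding L_def
      by (intro measurable_restrict_space1) (simp add: measurable_completion)
  qed
  have weight: "(\<integral>\<^sup>+ x. ennreal (phi_sigma \<sigma> (real n * x - of_int k)) \<partial>L) \<le> ennreal (N / real n)"
    for k :: int
  proof -
    have "(\<integral>\<^sup>+ x. ennreal (phi_sigma \<sigma> (real n * x - of_int k)) \<partial>L) \<le>
        (\<integral>\<^sup>+ x. ennreal (phi_sigma \<sigma> (real n * x - of_int k)) \<partial>lebesgue)"
      unfolding L_def by (subst nn_integral_restrict_space)
        (auto intro!: nn_integral_mono simp: indicator_def)
    also have "\<dots> = ennreal (N / real n)"
      unfolding N_def using n(1) by (intro nn_integral_phi_sigma_dilate \<sigma>) auto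
    finally show ?thesis .
  qed
  have third: "ennreal (1 / 3) * (ennreal s + ennreal u + ennreal v) = ennreal (1 / 3 * (s + u + v))"
    if "0 \<le> s" "0 \<le> u" "0 \<le> v" for s u v
    using that by (simp add: ennreal_mult'[symmetric] ennreal_plus[symmetric] del: ennreal_plus)
  have sum_prod: "(\<Sum>k\<in>J. ennreal (c k) * ennreal (u k)) = ennreal (\<Sum>k\<in>J. c k * u k)"
    if "\<And>k. 0 \<le> u k" for u
    using c0 that by (simp add: ennreal_mult[symmetric] sum_ennreal)
  have "modular \<phi> a b (\<lambda>x. l * (kantorovich_mp \<sigma> a b n f x - f x)) \<le>
    (\<integral>\<^sup>+ x. ennreal (1 / 3) *
       ((\<Sum>k\<in>J. ennreal (c k) * ennreal (phi_sigma \<sigma> (real n * x - of_int k))) +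
        ennreal (\<phi> G / real n) + ennreal (h x)) \<partial>L)"
    unfolding modular_def L_def[symmetric]
  proof (rule nn_integral_mono)
    fix x assume "x \<in> space L"
    then have x: "x \<in> {a..b}" by (simp add: L_def)
    have "\<phi> \<bar>l * (kantorovich_mp \<sigma> a b n f x - f x)\<bar> \<le>
        1 / 3 * ((\<Sum>k\<in>J. c k * phi_sigma \<sigma> (real n * x - of_int k)) + \<phi> G / real n + h x)"
      using phi_kantorovich_error_le[OF phi \<sigma> f g \<open>a < b\<close> h_int[unfolded h_def] n x]
      unfolding l_def c_def G_def J_def h_def by (simp add: mult.commute)
    also have "ennreal \<dots> = ennreal (1 / 3) *
       ((\<Sum>k\<in>J. ennreal (c k) * ennreal (phi_sigma \<sigma> (real n * x - of_int k))) +
        ennreal (\<phi> G / real n) + ennreal (h x))"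
      using c0 w0 h0 pos[OF lip(1)] by (simp add: sum_prod third sum_nonneg)
    finally show "ennreal (\<phi> \<bar>l * (kantorovich_mp \<sigma> a b n f x - f x)\<bar>) \<le> \<dots>"
      by (simp add: ennreal_leI)
  qed
  also have "\<dots> = ennreal (1 / 3) *
      ((\<Sum>k\<in>J. ennreal (c k) * (\<integral>\<^sup>+ x. ennreal (phi_sigma \<sigma> (real n * x - of_int k)) \<partial>L)) +
       ennreal (\<phi> G / real n) * emeasure L (space L) + (\<integral>\<^sup>+ x. ennreal (h x) \<partial>L))"
    by (simp add: nn_integral_cmult nn_integral_add nn_integral_sum)
  also have "\<dots> \<le> ennreal (1 / 3) *
      ((\<Sum>k\<in>J. ennreal (c k) * ennreal (N / real n)) +
       ennreal (\<phi> G / real n) * ennreal (b - a) + ennreal (integral {a..b} h))"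
    using \<open>a < b\<close> modI mod
    by (intro mult_left_mono add_mono sum_mono weight) (auto simp: L_def emeasure_restrict_space)
  also have "\<dots> = ennreal (1 / 3 *
      ((\<Sum>k\<in>J. c k * (N / real n)) + \<phi> G / real n * (b - a) + integral {a..b} h))"
    using c0 N pos[OF lip(1)] \<open>a < b\<close> integral_nonneg[OF h_int h0]
    by (simp add: sum_prod third sum_nonneg ennreal_mult[symmetric])
  also have "\<dots> \<le> ennreal ((N + 1) / 3 * integral {a..b} h + (b - a) / 3 * (\<phi> G / real n))"
  proof (rule ennreal_leI)
    have "(\<Sum>k\<in>J. c k * (N / real n)) =
       N * (\<Sum>k\<in>J. integral {of_int k / real n..(of_int k + 1) / real n} h)"
      using n(1) by (simp add: c_def sum_distrib_left mult.commute)
    also have "\<dots> \<le> N * integral {a..b} h"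
      unfolding J_def by (intro mult_left_mono integral_index_set_cells_le h_int h0 n N)
    finally have cells: "(\<Sum>k\<in>J. c k * (N / real n)) \<le> N * integral {a..b} h" .
    have "1 / 3 * (X + Y * (b - a) + Z) \<le> (N + 1) / 3 * Z + (b - a) / 3 * Y"
      if "X \<le> N * Z" for X Y Z
      using that by (simp add: field_simps)
    from this[OF cells] show "1 / 3 * ((\<Sum>k\<in>J. c k * (N / real n)) + \<phi> G / real n * (b - a) + integral {a..b} h)
      \<le> (N + 1) / 3 * integral {a..b} h + (b - a) / 3 * (\<phi> G / real n)"
      .
  qed
  also have "\<dots> = ennreal ((N + 1) / 3) * modular \<phi> a b (\<lambda>x. f x - g x) +
      ennreal ((b - a) / 3 * (\<phi> G / real n))"
    using N pos[OF lip(1)] \<open>a < b\<close> integral_nonneg[OF h_int h0]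
    unfolding modI by (subst ennreal_plus) (auto simp: ennreal_mult[symmetric])
  finally show ?thesis unfolding N_def G_def .
qed

theorem theorem5p1:
  fixes a b \<alpha> :: real and \<phi> \<sigma> f :: "real \<Rightarrow> real"
  assumes "a < b"
    and "phi_function \<phi>" and "convex_on {0..} \<phi>"
    and "sigmoidal \<sigma>" and "mono \<sigma>"
    and "Sigma1 \<sigma>" and "Sigma2 \<sigma>"
    and "\<alpha> \<ge> 1" and "Sigma3 \<sigma> \<alpha>"
    and "phi_sigma \<sigma> 2 > 0"
    and "f \<in> Orlicz_plus \<phi> a b"
  shows "\<exists>lam0>0. \<exists>lam1>0.
    (let A\<^sub>1 = norm1_phi_sigma \<sigma> + 1;
         A\<^sub>2 = 3 * lam0 * (b - a) / (4 * phi_sigma \<sigma> 2 * (norm1_phi_sigma \<sigma> + 1))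
     in \<forall>\<^sub>F n in sequentially.
          modular \<phi> a b (\<lambda>x. lam1 * (kantorovich_mp \<sigma> a b n f x - f x))
            \<le> ennreal A\<^sub>1 * K_functional \<phi> a b f lam0 (A\<^sub>2 / real n))"
proof -
  define N where "N = norm1_phi_sigma \<sigma>"
  define p where "p = phi_sigma \<sigma> 2"
  define l where "l = p / (3 * (N + 1))"
  define A2 where "A2 = 3 * 1 * (b - a) / (4 * p * (N + 1))"
  have N: "0 \<le> N" unfolding N_def by (rule norm1_phi_sigma_nonneg) fact+
  have p: "0 < p" "p \<le> 1 / 2" using assms(10) phi_sigma_bounds[OF assms(4,5)] by (auto simp: p_def)
  have f: "f absolutely_integrable_on {a..b}"
    using assms(11) by (intro Orlicz_space_absolutely_integrable[OF assms(2,3)])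
      (simp add: Orlicz_plus_def)
  have "modular \<phi> a b (\<lambda>x. l * (kantorovich_mp \<sigma> a b n f x - f x))
      \<le> ennreal (N + 1) * K_functional \<phi> a b f 1 (A2 / real n)"
    if n: "0 < n" "2 \<le> real n * (b - a)" for n
  proof -
    define E where "E = modular \<phi> a b (\<lambda>x. l * (kantorovich_mp \<sigma> a b n f x - f x))"
    have "E \<le> ennreal (N + 1) * (modular \<phi> a b (\<lambda>x. 1 * (f x - g x)) +
        ennreal (A2 / real n * \<phi> (sup_norm_on a b (deriv_on a b g))))"
      if g: "g \<in> C1_plus a b" for g
    proof -
      define q where "q = \<phi> (sup_norm_on a b (deriv_on a b g))"
      have "0 \<le> sup_norm_on a b (deriv_on a b g)"
        by (rule C1_plus_Lipschitz(1)[OF \<open>a < b\<close> g])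
      then have q: "0 \<le> q"
        using assms(2) unfolding phi_function_def q_def by (metis less_eq_real_def)
      have "E \<le> ennreal ((N + 1) / 3) * modular \<phi> a b (\<lambda>x. f x - g x) +
          ennreal ((b - a) / 3 * (q / real n))"
        unfolding E_def l_def N_def p_def q_def
        by (rule modular_kantorovich_error_le) (use assms f g n in auto)
      also have "\<dots> \<le> ennreal (N + 1) * modular \<phi> a b (\<lambda>x. f x - g x) +
          ennreal ((N + 1) * (A2 / real n * q))"
      proof (intro add_mono mult_right_mono ennreal_leI)
        \<comment> \<open>This is where \<open>p \<le> 1 / 2\<close> enters.\<close>
        have "1 / 3 \<le> 3 / (4 * p)" using p by (simp add: field_simps)
        then have "1 / 3 * ((b - a) * (q / real n)) \<le> 3 / (4 * p) * ((b - a) * (q / real n))"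
          using q \<open>a < b\<close> by (intro mult_right_mono) auto
        also have "\<dots> = (N + 1) * (A2 / real n * q)"
        proof -
          have "(N + 1) * A2 = 3 / (4 * p) * (b - a)"
            using N p by (simp add: A2_def divide_simps)
          then show ?thesis by (metis mult.assoc times_divide_eq_left times_divide_eq_right)
        qed
        finally show "(b - a) / 3 * (q / real n) \<le> (N + 1) * (A2 / real n * q)"
          by simp
      qed (use N in auto)
      also have "\<dots> = ennreal (N + 1) * (modular \<phi> a b (\<lambda>x. 1 * (f x - g x)) +
          ennreal (A2 / real n * q))"
        using N by (subst ennreal_mult') (auto simp: distrib_left simp del: ennreal_plus)
      finally show ?thesis unfolding q_def .
    qed
    then have "E / ennreal (N + 1) \<le> K_functional \<phi> a b f 1 (A2 / real n)"
      unfolding K_functional_def using N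
      by (intro INF_greatest divide_le_posI_ennreal)
        (auto simp: mult.commute simp del: ennreal_plus)
    then have "ennreal (N + 1) * (E / ennreal (N + 1)) \<le>
        ennreal (N + 1) * K_functional \<phi> a b f 1 (A2 / real n)"
      by (rule mult_left_mono) simp
    also have "ennreal (N + 1) * (E / ennreal (N + 1)) = E"
      using N by (simp add: ennreal_times_divide mult.commute[of _ E] ennreal_mult_divide_eq
          del: ennreal_plus)
    finally show ?thesis unfolding E_def .
  qed
  moreover have "eventually (\<lambda>n. 0 < n \<and> 2 \<le> real n * (b - a)) sequentially"
  proof -
    obtain m :: nat where m: "2 / (b - a) \<le> real m" using real_arch_simple by blast
    show ?thesis
      using eventually_ge_at_top[of "Suc m"]
    proof eventually_elim
      case (elim n)
      then have "2 / (b - a) \<le> real n" using m by linarith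
      then show ?case using \<open>a < b\<close> elim by (simp add: field_simps)
    qed
  qed
  ultimately have "\<forall>\<^sub>F n in sequentially.
      modular \<phi> a b (\<lambda>x. l * (kantorovich_mp \<sigma> a b n f x - f x))
      \<le> ennreal (N + 1) * K_functional \<phi> a b f 1 (A2 / real n)"
    by (auto elim: eventually_mono)
  moreover have "0 < l" using p N by (simp add: l_def)
  ultimately show ?thesis
    unfolding A2_def N_def p_def Let_def
    by (intro exI[of _ 1] conjI exI[of _ l]) auto
qed

end
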